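(* Let $A\in\mathbb{R}^{n\times n}$ be an invertible matrix such that $A^k=I$ for some $k\in\mathbb{N}$, and let $1<p<\infty$. Then $\mathcal{A}_{A,p}\subset\mathcal{A}_p$ and there exists a weight $w\in\mathcal{A}_p\setminus\mathcal{A}_{A,p}$. Moreover, $$\mathcal{A}_{A,p}=\{w\in\mathcal{A}_p:\ w(Ax)\lesssim w(x)\ \text{for a.e. }x\in\mathbb{R}^n\}.$$
   Context: A weight is a locally integrable function $w$ on $\mathbb{R}^n$ with $0<w<\infty$ a.e. Cubes $Q$ have sides parallel to the axes, and $w_A(x)=w(Ax)$. For $1<p<\infty$, a weight $w$ belongs to $\mathcal{A}_{A,p}$ if $[w]_{\mathcal{A}_{A,p}}=\sup_Q \frac1{|Q|}\int_Q w_A(x)\,dx\left(\frac1{|Q|}\int_Q w(x)^{-\frac1{p-1}}\,dx\right)^{p-1}<\infty$, the supremum being over all cubes $Q$; $\mathcal{A}_p=\mathcal{A}_{I,p}$ is the classical Muckenhoupt class. The notation $w(Ax)\lesssim w(x)$ a.e. means that there is a constant $C>0$ with $w(Ax)\le C\,w(x)$ for a.e. $x$.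
   Formalization: The existence of a weight in A_p \ A_{A,p} is claimed only for A ≠ I, since for A = I the two classes coincide by definition and the claim fails; the inclusion and the equality are for every A, with k ≥ 1. *)

theory Defs
  imports "HOL-Analysis.Analysis"
begin

text \<open>Powers of a square matrix for the matrix product; the type-class power on
  \<^typ>\<open>real ^ 'n ^ 'n\<close> would be componentwise.\<close>

definition mat_power :: "real ^ 'n ^ 'n \<Rightarrow> nat \<Rightarrow> real ^ 'n ^ 'n" where
  "mat_power A k = ((\<lambda>B. A ** B) ^^ k) (mat 1)"

text \<open>Real powers on \<open>[0, \<infinity>]\<close>, with \<open>\<infinity>\<close> and \<open>0\<close> treated as limits: \<open>\<infinity>\<^sup>r = \<infinity>\<close> and \<open>0\<^sup>r = 0\<close>
  for \<open>r > 0\<close>, and the other way round for \<open>r < 0\<close>.\<close>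

definition ennpowr :: "ennreal \<Rightarrow> real \<Rightarrow> ennreal" where
  "ennpowr x r =
    (if r = 0 then 1
     else if x = \<infinity> then (if r > 0 then \<infinity> else 0)
     else if x = 0 then (if r > 0 then 0 else \<infinity>)
     else ennreal (enn2real x powr r))"

lemma ennpowr_ennreal: "x > 0 \<Longrightarrow> ennpowr (ennreal x) r = ennreal (x powr r)"
  by (simp add: ennpowr_def)

definition cubes :: "(real ^ 'n) set set" where
  "cubes = {cbox a (\<chi> i. a $ i + l) | a l. l > 0}"

definition average :: "(real ^ 'n) set \<Rightarrow> (real ^ 'n \<Rightarrow> ennreal) \<Rightarrow> ennreal" where
  "average Q f = (\<integral>\<^sup>+x\<in>Q. f x \<partial>lebesgue) / emeasure lebesgue Q"

definition weight :: "(real ^ 'n \<Rightarrow> ennreal) \<Rightarrow> bool" where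
  "weight w \<longleftrightarrow>
     w \<in> borel_measurable lebesgue \<and>
     (\<forall>K. compact K \<longrightarrow> (\<integral>\<^sup>+x\<in>K. w x \<partial>lebesgue) < \<infinity>) \<and>
     (AE x in lebesgue. 0 < w x \<and> w x < \<infinity>)"

definition weight_comp :: "real ^ 'n ^ 'n \<Rightarrow> (real ^ 'n \<Rightarrow> ennreal) \<Rightarrow> real ^ 'n \<Rightarrow> ennreal" where
  "weight_comp A w x = w (A *v x)"

definition muckenhoupt_const ::
    "real ^ 'n ^ 'n \<Rightarrow> real \<Rightarrow> (real ^ 'n \<Rightarrow> ennreal) \<Rightarrow> ennreal" where
  "muckenhoupt_const A p w =
     (SUP Q\<in>cubes. average Q (weight_comp A w) *
        ennpowr (average Q (\<lambda>x. ennpowr (w x) (- 1 / (p - 1)))) (p - 1))"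

definition muckenhoupt_class :: "real ^ 'n ^ 'n \<Rightarrow> real \<Rightarrow> (real ^ 'n \<Rightarrow> ennreal) set" where
  "muckenhoupt_class A p = {w. weight w \<and> muckenhoupt_const A p w < \<infinity>}"

abbreviation classical_muckenhoupt_class :: "real \<Rightarrow> (real ^ 'n \<Rightarrow> ennreal) set" where
  "classical_muckenhoupt_class p \<equiv> muckenhoupt_class (mat 1) p"

definition ae_lesssim :: "(real ^ 'n \<Rightarrow> ennreal) \<Rightarrow> (real ^ 'n \<Rightarrow> ennreal) \<Rightarrow> bool" where
  "ae_lesssim f g \<longleftrightarrow> (\<exists>C>0::real. AE x in lebesgue. f x \<le> ennreal C * g x)"

end

theory Submission
  imports Defs
begin

text \<open>With \<open>\<sigma> = w powr (-1/(p-1))\<close>, Hoelder's inequality gives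
  \<open>1 \<le> \<langle>w\<rangle>\<^sub>Q \<langle>\<sigma>\<rangle>\<^sub>Q powr (p-1)\<close>, so membership in the class of \<open>A\<close> forces
  \<open>\<langle>w\<^sub>A\<rangle>\<^sub>Q \<le> C \<langle>w\<rangle>\<^sub>Q\<close> for every cube \<open>Q\<close>, and Lebesgue differentiation turns this into
  \<open>w\<^sub>A \<le> C w\<close> almost everywhere. Iterating along \<open>A\<^sup>k = I\<close> gives \<open>w \<le> C\<^sup>k\<^sup>-\<^sup>1 w\<^sub>A\<close>, so \<open>w\<close> and
  \<open>w\<^sub>A\<close> are comparable and the two Muckenhoupt constants are equivalent. If \<open>A \<noteq> I\<close>, some point
  \<open>x\<close> has \<open>(A x)\<^sub>i = c \<noteq> x\<^sub>i\<close>; the \<open>\<A>\<^sub>1\<close> weight \<open>\<bar>x\<^sub>i - c\<bar> powr (-1/2)\<close> then has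
  \<open>w\<^sub>A\<close> unbounded and \<open>w\<close> bounded near that point.\<close>

section \<open>Powers on the extended half-line\<close>

lemma borel_measurable_ennpowr [measurable]: "(\<lambda>x. ennpowr x r) \<in> borel_measurable borel"
  unfolding ennpowr_def by measurable

lemma ennpowr_mono:
  assumes "0 < r" "x \<le> y"
  shows "ennpowr x r \<le> ennpowr y r"
  using assms
  by (cases x rule: ennreal_cases; cases y rule: ennreal_cases)
    (auto simp: ennpowr_def ennreal_le_iff top_unique intro!: powr_mono2)

lemma ennpowr_antimono:
  assumes "r < 0" "x \<le> y"
  shows "ennpowr y r \<le> ennpowr x r"
  using assms
  by (cases x rule: ennreal_cases; cases y rule: ennreal_cases)
    (auto simp: ennpowr_def ennreal_le_iff top_unique intro!: powr_mono2')

section \<open>Null sets and measurability under an invertible matrix\<close>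

text \<open>The new exceptional set lies in the image of the old one under the inverse matrix, and
  linear maps send negligible sets to negligible sets.\<close>

lemma AE_lebesgue_linear_preimage:
  fixes A :: "real^'n^'n"
  assumes "invertible A" "AE x in lebesgue. P x"
  shows "AE x in lebesgue. P (A *v x)"
proof -
  obtain N where N: "negligible N" "{x. \<not> P x} \<subseteq> N"
    using assms(2) unfolding eventually_ae_filter_negligible by blast
  obtain B where B: "A ** B = mat 1" "B ** A = mat 1"
    using assms(1) unfolding invertible_def by blast
  have "negligible ((*v) B ` N)"
    using N(1) by (intro negligible_differentiable_image_negligible)
      (auto simp: linear_imp_differentiable_on matrix_vector_mul_linear)
  moreover have "{x. \<not> P (A *v x)} \<subseteq> (*v) B ` N"
  proof
    fix x assume "x \<in> {x. \<not> P (A *v x)}"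
    then have "A *v x \<in> N" using N(2) by auto
    moreover have "x = B *v (A *v x)"
      by (simp add: matrix_vector_mul_assoc B)
    ultimately show "x \<in> (*v) B ` N" by blast
  qed
  ultimately show ?thesis unfolding eventually_ae_filter_negligible by blast
qed

text \<open>Lebesgue measurability need not survive preimages under continuous maps. Here each
  preimage is also an image under the inverse matrix, and differentiable images of Lebesgue sets are
  again Lebesgue sets.\<close>

lemma borel_measurable_weight_comp:
  fixes A :: "real^'n^'n"
  assumes "invertible A" "w \<in> borel_measurable lebesgue"
  shows "weight_comp A w \<in> borel_measurable lebesgue"
proof (rule measurableI)
  obtain B where B: "A ** B = mat 1" "B ** A = mat 1"
    using assms(1) unfolding invertible_def by blast
  fix S :: "ennreal set" assume "S \<in> sets borel"
  then have "w -` S \<in> sets lebesgue" using measurable_sets[OF assms(2)] by simp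
  then have "(*v) B ` (w -` S) \<in> sets lebesgue"
    by (intro differentiable_image_in_sets_lebesgue)
      (auto simp: linear_imp_differentiable_on matrix_vector_mul_linear)
  moreover have "(*v) B ` (w -` S) = weight_comp A w -` S"
  proof -
    have "A *v (B *v y) = y" "B *v (A *v y) = y" for y
      by (simp_all add: matrix_vector_mul_assoc B)
    then show ?thesis unfolding weight_comp_def image_def vimage_def by (auto; metis)
  qed
  ultimately show "weight_comp A w -` S \<inter> space lebesgue \<in> sets lebesgue" by simp
qed simp

section \<open>Cubes and averages over them\<close>

text \<open>Translates the coordinate form used in \<open>cubes\<close> into the vector form in
  which box volumes and differentiation along cubes are available.\<close>

lemma cube_eq: "cbox a (\<chi> i. a $ i + l) = cbox a (a + l *\<^sub>R One)" for a :: "real^'n"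
proof -
  have "(\<chi> i. a $ i + l) = a + l *\<^sub>R One" by (simp add: vec_eq_iff) (metis (lifting) ext Cart_1 one_index sum_component)
  then show ?thesis by simp
qed

lemma emeasure_cube:
  fixes a :: "real^'n"
  assumes "0 < l"
  shows "emeasure lebesgue (cbox a (\<chi> i. a $ i + l)) = ennreal (l ^ CARD('n))"
proof -
  have "a \<bullet> b \<le> (a + l *\<^sub>R One) \<bullet> b" if "b \<in> Basis" for b
    using assms that by (simp add: inner_add_left)
  then show ?thesis
    unfolding cube_eq by (simp add: emeasure_lborel_cbox_eq inner_add_left)
qed

lemma cubesE:
  fixes Q :: "(real^'n) set"
  assumes "Q \<in> cubes"
  obtains "Q \<in> sets lebesgue" "compact Q" "0 < emeasure lebesgue Q" "emeasure lebesgue Q < \<infinity>"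
proof -
  obtain a l where Q: "Q = cbox a (\<chi> i. a $ i + l)" "l > 0"
    using assms by (auto simp: cubes_def)
  then show ?thesis using emeasure_cube[of l a] by (intro that) auto
qed

text \<open>Carries integrability from cubes to arbitrary boxes and compact sets.\<close>

lemma bounded_subset_cube:
  fixes S :: "(real^'n) set"
  assumes "bounded S"
  shows "\<exists>Q\<in>cubes. S \<subseteq> Q"
proof -
  obtain B where B: "B > 0" "\<And>x. x \<in> S \<Longrightarrow> norm x \<le> B"
    using assms by (auto simp: bounded_pos)
  let ?Q = "cbox (\<chi> i. - B) (\<chi> i. (\<chi> i. - B) $ i + 2 * B) :: (real^'n) set"
  have "S \<subseteq> ?Q"
  proof
    fix x assume "x \<in> S"
    then have "\<bar>x $ i\<bar> \<le> B" for i using B(2) component_le_norm_cart order_trans by blast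
    then show "x \<in> ?Q" by (auto simp: mem_box_cart abs_le_iff minus_le_iff)
  qed
  moreover have "?Q \<in> cubes"
    unfolding cubes_def using B(1)
    by (intro CollectI, intro exI[of _ "\<chi> i. - B"] exI[of _ "2 * B"]) simp
  ultimately show ?thesis by blast
qed

lemma average_mono_AE:
  assumes "AE x in lebesgue. f x \<le> g x"
  shows "average Q f \<le> average Q g"
  unfolding average_def
  by (intro divide_right_mono_ennreal nn_integral_mono_AE eventually_mono[OF assms] mult_right_mono) auto

lemma average_mono:
  assumes "\<And>x. x \<in> Q \<Longrightarrow> f x \<le> g x"
  shows "average Q f \<le> average Q g"
  unfolding average_def using assms
  by (intro divide_right_mono_ennreal nn_integral_mono) (auto simp: indicator_def)

lemma average_const:
  assumes "Q \<in> cubes"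
  shows "average Q (\<lambda>x. c) = c"
  using assms
  by (rule cubesE) (simp add: average_def nn_integral_cmult_indicator ennreal_mult_divide_eq)

lemma average_cmult:
  assumes "Q \<in> cubes" "f \<in> borel_measurable lebesgue"
  shows "average Q (\<lambda>x. c * f x) = c * average Q f"
proof -
  from assms(1) have "Q \<in> sets lebesgue" by (rule cubesE)
  with assms(2) have "(\<integral>\<^sup>+x\<in>Q. c * f x \<partial>lebesgue) = c * (\<integral>\<^sup>+x\<in>Q. f x \<partial>lebesgue)"
    by (subst nn_integral_cmult[symmetric]) (auto simp: mult.assoc)
  then show ?thesis
    by (simp add: average_def ennreal_times_divide)
qed

lemma average_add:
  assumes "Q \<in> cubes" "f \<in> borel_measurable lebesgue" "g \<in> borel_measurable lebesgue"
  shows "average Q (\<lambda>x. f x + g x) = average Q f + average Q g"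
proof -
  from assms(1) have "Q \<in> sets lebesgue" by (rule cubesE)
  with assms(2,3) have "(\<integral>\<^sup>+x\<in>Q. (f x + g x) \<partial>lebesgue) = (\<integral>\<^sup>+x\<in>Q. f x \<partial>lebesgue) + (\<integral>\<^sup>+x\<in>Q. g x \<partial>lebesgue)"
    by (subst nn_integral_add[symmetric]) (auto simp: distrib_right)
  then show ?thesis
    by (simp add: average_def add_divide_distrib_ennreal)
qed

lemma average_mult_emeasure:
  assumes "Q \<in> cubes"
  shows "average Q f * emeasure lebesgue Q = (\<integral>\<^sup>+x\<in>Q. f x \<partial>lebesgue)"
  using assms
  by (rule cubesE) (simp add: average_def ennreal_divide_times ennreal_mult_divide_eq)

text \<open>Finiteness is local integrability on the compact set \<open>Q\<close>. A vanishing
  integral would force \<open>w\<close> to be zero almost everywhere on \<open>Q\<close>, which has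
  positive measure.\<close>

lemma weight_average:
  assumes "weight w" "Q \<in> cubes"
  shows "0 < average Q w" "average Q w < \<infinity>"
proof -
  from assms(2) have Q: "Q \<in> sets lebesgue" "compact Q" "0 < emeasure lebesgue Q" "emeasure lebesgue Q < \<infinity>"
    by (auto elim: cubesE)
  have w: "w \<in> borel_measurable lebesgue" "(\<integral>\<^sup>+x\<in>Q. w x \<partial>lebesgue) < \<infinity>"
    "AE x in lebesgue. 0 < w x"
    using assms(1) Q(2) by (auto simp: weight_def)
  show "average Q w < \<infinity>"
    using w(2) Q(3) by (simp add: average_def ennreal_divide_eq_top_iff less_top[symmetric] zero_less_iff_neq_zero)
  have "(\<integral>\<^sup>+x\<in>Q. w x \<partial>lebesgue) \<noteq> 0"
  proof
    assume "(\<integral>\<^sup>+x\<in>Q. w x \<partial>lebesgue) = 0"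
    then have "AE x in lebesgue. w x * indicator Q x = 0"
      using w(1) Q(1) by (subst (asm) nn_integral_0_iff_AE) auto
    with w(3) have "AE x in lebesgue. x \<notin> Q"
      by eventually_elim (auto simp: indicator_def split: if_splits)
    with Q(1,3) show False by (subst (asm) AE_iff_measurable[OF _ refl]) auto
  qed
  then show "0 < average Q w"
    using Q(4) by (simp add: average_def ennreal_zero_less_divide zero_less_iff_neq_zero)
qed

section \<open>Lebesgue differentiation along cubes\<close>

text \<open>For almost every \<open>x\<close>, the averages of \<open>g - f\<close> over cubes with
  lower corner \<open>x\<close> converge to \<open>g x - f x\<close> as the side shrinks, and these
  averages are nonnegative.\<close>

lemma AE_le_of_cube_integrals_le:
  fixes f g :: "real^'n \<Rightarrow> ennreal"
  assumes meas: "f \<in> borel_measurable lebesgue" "g \<in> borel_measurable lebesgue"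
    and fin: "AE x in lebesgue. f x < \<infinity>" "AE x in lebesgue. g x < \<infinity>"
    and le: "\<And>Q. Q \<in> cubes \<Longrightarrow> (\<integral>\<^sup>+x\<in>Q. f x \<partial>lebesgue) \<le> (\<integral>\<^sup>+x\<in>Q. g x \<partial>lebesgue)"
    and loc: "\<And>Q. Q \<in> cubes \<Longrightarrow> (\<integral>\<^sup>+x\<in>Q. g x \<partial>lebesgue) < \<infinity>"
  shows "AE x in lebesgue. f x \<le> g x"
proof -
  \<comment> \<open>Differences and the differentiation theorem need real values; finiteness almost
    everywhere makes this passage harmless.\<close>
  define F G where "F x = enn2real (f x)" and "G x = enn2real (g x)" for x
  have [measurable]: "F \<in> borel_measurable lebesgue" "G \<in> borel_measurable lebesgue"
    unfolding F_def G_def using meas by measurable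
  have [simp]: "0 \<le> F x" "0 \<le> G x" for x
    by (simp_all add: F_def G_def)
  have nnF: "(\<integral>\<^sup>+x. ennreal (indicator Q x *\<^sub>R F x) \<partial>lebesgue) = (\<integral>\<^sup>+x\<in>Q. f x \<partial>lebesgue)" for Q
    by (intro nn_integral_cong_AE eventually_mono[OF fin(1)]) (auto simp: F_def indicator_def)
  have nnG: "(\<integral>\<^sup>+x. ennreal (indicator Q x *\<^sub>R G x) \<partial>lebesgue) = (\<integral>\<^sup>+x\<in>Q. g x \<partial>lebesgue)" for Q
    by (intro nn_integral_cong_AE eventually_mono[OF fin(2)]) (auto simp: G_def indicator_def)
  have F_int: "set_integrable lebesgue Q F" and G_int: "set_integrable lebesgue Q G" if "Q \<in> cubes" for Q
  proof -
    have [measurable]: "Q \<in> sets lebesgue" using that by (rule cubesE)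
    show "set_integrable lebesgue Q F"
      unfolding set_integrable_def
    proof (rule integrableI_nonneg)
      show "(\<integral>\<^sup>+x. ennreal (indicator Q x *\<^sub>R F x) \<partial>lebesgue) < \<infinity>"
        unfolding nnF using le[OF that] loc[OF that] by simp
    qed simp_all
    show "set_integrable lebesgue Q G"
      unfolding set_integrable_def
    proof (rule integrableI_nonneg)
      show "(\<integral>\<^sup>+x. ennreal (indicator Q x *\<^sub>R G x) \<partial>lebesgue) < \<infinity>"
        unfolding nnG using loc[OF that] by simp
    qed simp_all
  qed
  have D_int: "set_integrable lebesgue Q (\<lambda>x. G x - F x)" if "Q \<in> cubes" for Q
    using F_int[OF that] G_int[OF that] by (rule set_integral_diff(1)[rotated])
  have pos: "0 \<le> integral Q (\<lambda>x. G x - F x)" if "Q \<in> cubes" for Q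
  proof -
    have [measurable]: "Q \<in> sets lebesgue" using that by (rule cubesE)
    have "(LINT x:Q|lebesgue. F x) \<le> (LINT x:Q|lebesgue. G x)"
      unfolding set_lebesgue_integral_def
      using le[OF that] loc[OF that]
      by (subst (1 2) integral_eq_nn_integral)
        (auto simp: nnF[unfolded real_scaleR_def] nnG[unfolded real_scaleR_def]
          intro!: enn2real_mono)
    then have "0 \<le> (LINT x:Q|lebesgue. G x - F x)"
      using F_int[OF that] G_int[OF that] by (simp add: set_integral_diff)
    then show ?thesis
      using set_lebesgue_integral_eq_integral(2)[OF D_int[OF that]] by simp
  qed
  have "(\<lambda>x. G x - F x) integrable_on cbox a b" for a b
  proof -
    obtain Q where "Q \<in> cubes" "cbox a b \<subseteq> Q"
      using bounded_subset_cube[OF bounded_cbox] by blast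
    moreover from this(1) obtain a' b' where "Q = cbox a' b'" by (auto simp: cubes_def)
    ultimately show ?thesis
      using set_lebesgue_integral_eq_integral(1)[OF D_int[of Q]] integrable_on_subcbox by metis
  qed
  from integrable_ccontinuous_explicit[OF this]
  obtain N where N: "negligible N"
    and lim: "\<And>x e. \<lbrakk>x \<notin> N; 0 < e\<rbrakk> \<Longrightarrow> \<exists>d>0. \<forall>h. 0 < h \<and> h < d \<longrightarrow>
       norm (integral (cbox x (x + h *\<^sub>R One)) (\<lambda>x. G x - F x) /\<^sub>R h ^ DIM(real^'n) - (G x - F x)) < e"
    by blast
  have "AE x in lebesgue. F x \<le> G x"
    unfolding eventually_ae_filter_negligible
  proof (intro exI conjI subsetI)
    show "negligible N" by fact
    fix x assume x: "x \<in> {x. \<not> F x \<le> G x}"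
    show "x \<in> N"
    proof (rule ccontr)
      assume "x \<notin> N"
      \<comment> \<open>With tolerance \<open>F x - G x\<close>, being this close to
        \<open>G x - F x\<close> makes the average negative, against \<open>pos\<close>.\<close>
      with x obtain d where d: "d > 0" "\<And>h. 0 < h \<and> h < d \<Longrightarrow>
         norm (integral (cbox x (x + h *\<^sub>R One)) (\<lambda>x. G x - F x) /\<^sub>R h ^ DIM(real^'n) - (G x - F x)) < F x - G x"
        using lim[of x "F x - G x"] by auto
      have "cbox x (x + (d/2) *\<^sub>R One) \<in> cubes"
        unfolding cubes_def using d(1) by (auto simp: cube_eq[symmetric] intro!: exI[of _ x] exI[of _ "d/2"])
      from pos[OF this] have "0 \<le> integral (cbox x (x + (d/2) *\<^sub>R One)) (\<lambda>x. G x - F x) /\<^sub>R (d/2) ^ DIM(real^'n)"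
        using d(1) by simp
      with d(2)[of "d/2"] d(1) show False by (simp del: scaleR_conv_of_real)
    qed
  qed
  with fin show ?thesis
    by eventually_elim (auto simp: F_def G_def enn2real_le_iff less_top intro: order.trans dest: ennreal_leI)
qed

section \<open>The Muckenhoupt product and Hoelder's inequality\<close>

text \<open>The exponents multiply to -1, and the conventions of \<open>ennpowr\<close> at 0 and
  infinity agree with those of \<open>inverse\<close>.\<close>

lemma ennpowr_ennpowr_minus_one:
  assumes "1 < p"
  shows "ennpowr (ennpowr x (- 1 / (p - 1))) (p - 1) = inverse x"
  using assms
  by (cases x rule: ennreal_cases)
    (auto simp: ennpowr_def powr_powr inverse_ennreal divide_less_0_iff powr_minus_divide powr_divide inverse_eq_divide)

lemma weight_comp_mat_1 [simp]: "weight_comp (mat 1) w = w"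
  by (simp add: fun_eq_iff weight_comp_def)

lemma muckenhoupt_const_ge:
  assumes "Q \<in> cubes"
  shows "average Q (weight_comp A w) * ennpowr (average Q (\<lambda>x. ennpowr (w x) (- 1 / (p - 1)))) (p - 1)
    \<le> muckenhoupt_const A p w"
  unfolding muckenhoupt_const_def using assms by (rule SUP_upper)

text \<open>Young's inequality with weights \<open>1/p\<close> and \<open>1 - 1/p\<close> is applied
  pointwise to \<open>w / W\<close> and its power \<open>- 1 / (p - 1)\<close>, where
  \<open>W\<close> is the average of \<open>w\<close>, and then averaged over
  \<open>Q\<close>.\<close>

lemma average_Hoelder:
  assumes "weight w" "Q \<in> cubes" "1 < p"
  shows "1 \<le> average Q w * ennpowr (average Q (\<lambda>x. ennpowr (w x) (- 1 / (p - 1)))) (p - 1)"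
proof -
  define \<sigma> where "\<sigma> = (\<lambda>x. ennpowr (w x) (- 1 / (p - 1)))"
  have w[measurable]: "w \<in> borel_measurable lebesgue" using assms(1) by (simp add: weight_def)
  have s[measurable]: "\<sigma> \<in> borel_measurable lebesgue" unfolding \<sigma>_def by measurable
  obtain W where W: "average Q w = ennreal W" "W > 0"
    using weight_average[OF assms(1,2)] by (cases "average Q w" rule: ennreal_cases) auto
  show ?thesis
  proof (cases "average Q \<sigma> = \<infinity>")
    case True
    then show ?thesis
      using assms(3) W unfolding \<sigma>_def[symmetric] by (simp add: ennpowr_def ennreal_mult_top)
  next
    case False
    then obtain S where S: "average Q \<sigma> = ennreal S" "S \<ge> 0"
      by (cases "average Q \<sigma>" rule: ennreal_cases) auto
    \<comment> \<open>The factor \<open>W powr (1 / (p - 1))\<close> comes from normalising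
      \<open>w\<close> by its average before raising it to the power
      \<open>- 1 / (p - 1)\<close>.\<close>
    define c where "c = (1 - 1/p) * W powr (1 / (p - 1))"
    have c: "c \<ge> 0" using assms(3) by (simp add: c_def)
    have "AE x in lebesgue. 0 < w x \<and> w x < \<infinity>" using assms(1) by (simp add: weight_def)
    then have "AE x in lebesgue. 1 \<le> ennreal (1 / (p * W)) * w x + ennreal c * \<sigma> x"
    proof eventually_elim
      fix x assume "0 < w x \<and> w x < \<infinity>"
      then obtain a where a: "w x = ennreal a" "a > 0" by (cases "w x" rule: ennreal_cases) auto
      \<comment> \<open>The exponents cancel, so the geometric mean on the left of Young's
        inequality is 1.\<close>
      have "(a / W) powr (1/p) * ((a / W) powr (- 1 / (p - 1))) powr (1 - 1/p)
          = (a / W) powr (1/p + (- 1 / (p - 1)) * (1 - 1/p))"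
        by (simp only: powr_powr powr_add)
      also have "1/p + (- 1 / (p - 1)) * (1 - 1/p) = 0" using assms(3) by (simp add: field_simps)
      finally have "1 \<le> (1/p) * (a / W) + (1 - 1/p) * (a / W) powr (- 1 / (p - 1))"
        using Youngs_inequality_0[of "1/p" "1 - 1/p" "a / W" "(a / W) powr (- 1 / (p - 1))"] assms(3) a W
        by simp
      also have "(a / W) powr (- 1 / (p - 1)) = W powr (1 / (p - 1)) * a powr (- 1 / (p - 1))"
        using a W by (simp add: powr_divide powr_minus field_simps)
      finally have "1 \<le> ennreal (1 / (p * W) * a + c * a powr (- 1 / (p - 1)))"
        by (simp add: c_def mult.assoc)
      also have "\<dots> = ennreal (1 / (p * W)) * w x + ennreal c * \<sigma> x"
      proof -
        have "ennreal (1 / (p * W) * a) = ennreal (1 / (p * W)) * ennreal a"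
          "ennreal (c * a powr (- 1 / (p - 1))) = ennreal c * ennreal (a powr (- 1 / (p - 1)))"
          using a W c assms(3) by (intro ennreal_mult; simp)+
        then show ?thesis
          using a W c assms(3) by (simp add: \<sigma>_def ennpowr_ennreal ennreal_plus del: times_divide_eq_left)
      qed
      finally show "1 \<le> ennreal (1 / (p * W)) * w x + ennreal c * \<sigma> x" .
    qed
    from average_mono_AE[OF this, of Q]
    have "1 \<le> ennreal (1 / (p * W)) * average Q w + ennreal c * average Q \<sigma>"
      using assms(2) by (simp add: average_const average_add average_cmult)
    also have "\<dots> = ennreal (1 / p + c * S)"
      using W S c assms(3) by (simp add: ennreal_plus ennreal_mult[symmetric])
    finally have "1 \<le> 1 / p + c * S" using c S assms(3) by (simp add: ennreal_1[symmetric] del: ennreal_1 flip: ennreal_plus)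
    then have "(1 - 1/p) * 1 \<le> (1 - 1/p) * (W powr (1 / (p - 1)) * S)"
      by (simp add: c_def algebra_simps)
    then have *: "1 \<le> W powr (1 / (p - 1)) * S"
      using assms(3) by (subst (asm) mult_le_cancel_left_pos) auto
    then have "S > 0" using S W by (cases "S = 0") auto
    have "1 powr (p - 1) \<le> (W powr (1 / (p - 1)) * S) powr (p - 1)"
      using * assms(3) by (intro powr_mono2) auto
    also have "\<dots> = W * S powr (p - 1)"
      using W S assms(3) by (simp add: powr_mult powr_powr)
    finally have "1 \<le> ennreal (W * S powr (p - 1))" by simp
    also have "\<dots> = average Q w * ennpowr (average Q \<sigma>) (p - 1)"
      using W S \<open>S > 0\<close> by (simp add: ennpowr_ennreal ennreal_mult)
    finally show ?thesis unfolding \<sigma>_def .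
  qed
qed

section \<open>Characterisation of the class by pointwise comparison\<close>

text \<open>The dual factor of the Muckenhoupt product does not involve the matrix, so only the
  first average has to be compared. Allowing two matrices serves both inclusions of the
  characterisation.\<close>

lemma mem_muckenhoupt_class_of_comp_le:
  fixes A B :: "real^'n^'n"
  assumes w: "w \<in> muckenhoupt_class B p" and B: "invertible B"
    and le: "AE x in lebesgue. weight_comp A w x \<le> ennreal C * weight_comp B w x"
  shows "w \<in> muckenhoupt_class A p"
proof -
  have meas: "weight_comp B w \<in> borel_measurable lebesgue"
    using w B by (simp add: borel_measurable_weight_comp muckenhoupt_class_def weight_def)
  have "muckenhoupt_const A p w \<le> ennreal C * muckenhoupt_const B p w"
    unfolding muckenhoupt_const_def[of A]
  proof (rule SUP_least)
    fix Q :: "(real^'n) set" assume Q: "Q \<in> cubes"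
    let ?s = "ennpowr (average Q (\<lambda>x. ennpowr (w x) (- 1 / (p - 1)))) (p - 1)"
    have "average Q (weight_comp A w) \<le> ennreal C * average Q (weight_comp B w)"
      using average_mono_AE[OF le, of Q] by (simp only: average_cmult[OF Q meas])
    then have "average Q (weight_comp A w) * ?s \<le> ennreal C * (average Q (weight_comp B w) * ?s)"
      unfolding mult.assoc[symmetric] by (rule mult_right_mono) simp
    also have "\<dots> \<le> ennreal C * muckenhoupt_const B p w"
      by (intro mult_left_mono muckenhoupt_const_ge[OF Q]) simp
    finally show "average Q (weight_comp A w) * ?s \<le> ennreal C * muckenhoupt_const B p w" .
  qed
  also have "\<dots> < \<infinity>"
    using w by (simp add: muckenhoupt_class_def ennreal_mult_less_top)
  finally show ?thesis using w by (simp add: muckenhoupt_class_def)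
qed

lemma muckenhoupt_class_imp_ae_lesssim:
  fixes A :: "real^'n^'n"
  assumes "invertible A" "1 < p" and w: "w \<in> muckenhoupt_class A p"
  shows "ae_lesssim (weight_comp A w) w"
proof -
  have wt: "weight w" and fin: "muckenhoupt_const A p w < \<infinity>"
    using w by (auto simp: muckenhoupt_class_def)
  have meas[measurable]: "w \<in> borel_measurable lebesgue" using wt by (simp add: weight_def)
  have AEw: "AE x in lebesgue. 0 < w x \<and> w x < \<infinity>" using wt by (simp add: weight_def)
  \<comment> \<open>Adding 1 makes the constant strictly positive, as \<open>ae_lesssim\<close>
    demands.\<close>
  define C where "C = enn2real (muckenhoupt_const A p w) + 1"
  have C: "C > 0" "muckenhoupt_const A p w \<le> ennreal C"
    using fin by (auto simp: C_def ennreal_plus add_nonneg_pos less_top)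
  have "AE x in lebesgue. weight_comp A w x \<le> ennreal C * w x"
  proof (rule AE_le_of_cube_integrals_le)
    show "weight_comp A w \<in> borel_measurable lebesgue"
      using assms(1) meas by (rule borel_measurable_weight_comp)
    show "AE x in lebesgue. weight_comp A w x < \<infinity>"
      unfolding weight_comp_def
      using AE_lebesgue_linear_preimage[OF assms(1) AEw] by eventually_elim simp
    show "AE x in lebesgue. ennreal C * w x < \<infinity>"
      using AEw by eventually_elim (simp add: ennreal_mult_less_top)
    fix Q :: "(real^'n) set" assume Q: "Q \<in> cubes"
    let ?s = "ennpowr (average Q (\<lambda>x. ennpowr (w x) (- 1 / (p - 1)))) (p - 1)"
    \<comment> \<open>Hoelder's bound is inserted as a factor; regrouping then isolates the product
      controlled by \<open>muckenhoupt_const A p w\<close> and leaves the average of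
      \<open>w\<close>.\<close>
    have "average Q (weight_comp A w) * 1 \<le> average Q (weight_comp A w) * (average Q w * ?s)"
      by (intro mult_left_mono average_Hoelder[OF wt Q assms(2)]) simp
    also have "\<dots> = (average Q (weight_comp A w) * ?s) * average Q w" by (simp add: ac_simps)
    also have "\<dots> \<le> ennreal C * average Q w"
      using muckenhoupt_const_ge[OF Q, of A w p] C(2) by (intro mult_right_mono) auto
    finally have le: "average Q (weight_comp A w) \<le> average Q (\<lambda>x. ennreal C * w x)"
      by (simp add: average_cmult[OF Q meas])
    show "(\<integral>\<^sup>+x\<in>Q. weight_comp A w x \<partial>lebesgue) \<le> (\<integral>\<^sup>+x\<in>Q. ennreal C * w x \<partial>lebesgue)"
      using mult_right_mono[OF le, of "emeasure lebesgue Q"]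
      by (simp add: average_mult_emeasure[OF Q])
    have "average Q (\<lambda>x. ennreal C * w x) < \<infinity>"
      using weight_average(2)[OF wt Q] by (simp add: average_cmult[OF Q meas] ennreal_mult_less_top)
    moreover have "emeasure lebesgue Q < \<infinity>" using Q by (rule cubesE)
    ultimately show "(\<integral>\<^sup>+x\<in>Q. ennreal C * w x \<partial>lebesgue) < \<infinity>"
      unfolding average_mult_emeasure[OF Q, symmetric] by (simp add: ennreal_mult_less_top)
  qed measurable
  then show ?thesis using C(1) unfolding ae_lesssim_def by blast
qed

text \<open>With the extra factor on the right, \<open>A\<close> acts on the point first, so the
  bound for \<open>m\<close> can be used at \<open>A *v x\<close>.\<close>

lemma mat_power_Suc_right: "mat_power A (Suc m) = mat_power A m ** A"
  by (induction m) (simp_all add: mat_power_def matrix_mul_assoc)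

lemma weight_comp_mat_power_le:
  fixes A :: "real^'n^'n"
  assumes A: "invertible A" and C: "C \<ge> 0"
    and le: "AE x in lebesgue. weight_comp A w x \<le> ennreal C * w x"
  shows "AE x in lebesgue. weight_comp (mat_power A m) w x \<le> ennreal (C ^ m) * w x"
proof (induction m)
  case 0
  show ?case by (simp add: mat_power_def weight_comp_def)
next
  case (Suc m)
  have "AE x in lebesgue. weight_comp (mat_power A m) w (A *v x) \<le> ennreal (C ^ m) * w (A *v x)"
    using A Suc by (rule AE_lebesgue_linear_preimage)
  with le show ?case
  proof eventually_elim
    fix x assume 1: "weight_comp A w x \<le> ennreal C * w x"
      and 2: "weight_comp (mat_power A m) w (A *v x) \<le> ennreal (C ^ m) * w (A *v x)"
    have "weight_comp (mat_power A (Suc m)) w x \<le> ennreal (C ^ m) * weight_comp A w x"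
      using 2 by (simp add: mat_power_Suc_right weight_comp_def matrix_vector_mul_assoc)
    also have "\<dots> \<le> ennreal (C ^ m) * (ennreal C * w x)" using 1 by (rule mult_left_mono) simp
    finally show "weight_comp (mat_power A (Suc m)) w x \<le> ennreal (C ^ Suc m) * w x"
      using C by (simp add: ennreal_mult ac_simps)
  qed
qed

text \<open>Since \<open>A\<close> has finite order, its inverse is one of its powers. Iterating the
  one-sided bound therefore gives the reverse bound, which yields the classical condition.\<close>

lemma muckenhoupt_class_eq:
  fixes A :: "real^'n^'n"
  assumes A: "invertible A" and k: "k \<ge> 1" "mat_power A k = mat 1" and p: "1 < p"
  shows "muckenhoupt_class A p = {w \<in> classical_muckenhoupt_class p. ae_lesssim (weight_comp A w) w}"
proof (intro equalityI subsetI)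
  fix w assume w: "w \<in> muckenhoupt_class A p"
  from muckenhoupt_class_imp_ae_lesssim[OF A p w]
  obtain C where C: "C > 0" "AE x in lebesgue. weight_comp A w x \<le> ennreal C * w x"
    unfolding ae_lesssim_def by blast
  \<comment> \<open>With \<open>m = k - 1\<close>, the matrix \<open>mat_power A m\<close> is the
    inverse of \<open>A\<close>, so the iterated bound taken at \<open>A *v x\<close> has
    \<open>w x\<close> on its left.\<close>
  obtain m where m: "k = Suc m" using k(1) by (cases k) auto
  have "AE x in lebesgue. weight_comp (mat_power A m) w (A *v x) \<le> ennreal (C ^ m) * w (A *v x)"
    using A weight_comp_mat_power_le[OF A _ C(2)] C(1) by (intro AE_lebesgue_linear_preimage) auto
  moreover have "mat_power A m *v (A *v x) = x" for x
    using k(2) by (simp add: m mat_power_Suc_right matrix_vector_mul_assoc)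
  ultimately have "AE x in lebesgue. weight_comp (mat 1) w x \<le> ennreal (C ^ m) * weight_comp A w x"
    by (simp add: weight_comp_def)
  from mem_muckenhoupt_class_of_comp_le[OF w A this] muckenhoupt_class_imp_ae_lesssim[OF A p w]
  show "w \<in> {w \<in> classical_muckenhoupt_class p. ae_lesssim (weight_comp A w) w}" by blast
next
  fix w assume "w \<in> {w \<in> classical_muckenhoupt_class p. ae_lesssim (weight_comp A w) w}"
  then obtain C where w: "w \<in> classical_muckenhoupt_class p"
    and C: "AE x in lebesgue. weight_comp A w x \<le> ennreal C * w x"
    unfolding ae_lesssim_def by blast
  have "AE x in lebesgue. weight_comp A w x \<le> ennreal C * weight_comp (mat 1) w x"
    using C by (simp add: weight_comp_def)
  from mem_muckenhoupt_class_of_comp_le[OF w _ this]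
  show "w \<in> muckenhoupt_class A p" by (auto simp: invertible_def)
qed

section \<open>The A_1 condition implies the A_p condition\<close>

text \<open>The A_1 bound gives \<open>w \<ge> M\<close> on \<open>Q\<close>, where \<open>M\<close>
  is the average divided by \<open>K\<close>. Hence the dual factor is at most
  \<open>inverse M\<close>, and the product is at most \<open>K\<close>.\<close>

lemma mem_classical_muckenhoupt_class_of_average_le:
  assumes wt: "weight w" and p: "1 < p"
    and A1: "\<And>Q x. Q \<in> cubes \<Longrightarrow> x \<in> Q \<Longrightarrow> average Q w \<le> ennreal K * w x"
  shows "w \<in> classical_muckenhoupt_class p"
proof -
  have "muckenhoupt_const (mat 1) p w \<le> ennreal K"
    unfolding muckenhoupt_const_def
  proof (rule SUP_least)
    fix Q :: "(real^'a) set" assume Q: "Q \<in> cubes"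
    define M where "M = average Q w / ennreal K"
    have W: "0 < average Q w" "average Q w < \<infinity>" using weight_average[OF wt Q] .
    \<comment> \<open>A single point of \<open>Q\<close> shows \<open>K > 0\<close>: otherwise
      \<open>ennreal K\<close> is 0 and the positive average would vanish.\<close>
    from Q have "Q \<noteq> {}" by (rule cubesE) auto
    then obtain z where "z \<in> Q" by blast
    with A1[OF Q this] W have K: "K > 0" by (cases "K > 0") (auto simp: ennreal_neg)
    have "M \<le> w x" if "x \<in> Q" for x
    proof -
      have "M \<le> ennreal K * w x / ennreal K"
        unfolding M_def using A1[OF Q that] by (rule divide_right_mono_ennreal)
      also have "\<dots> = w x" using K ennreal_mult_divide_eq[of "ennreal K" "w x"] by (simp add: mult.commute)
      finally show ?thesis .
    qed
    then have "average Q (\<lambda>x. ennpowr (w x) (- 1 / (p - 1))) \<le> average Q (\<lambda>x. ennpowr M (- 1 / (p - 1)))"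
      using p by (intro average_mono ennpowr_antimono) auto
    also have "\<dots> = ennpowr M (- 1 / (p - 1))" by (rule average_const[OF Q])
    finally have "ennpowr (average Q (\<lambda>x. ennpowr (w x) (- 1 / (p - 1)))) (p - 1)
        \<le> ennpowr (ennpowr M (- 1 / (p - 1))) (p - 1)"
      using p by (intro ennpowr_mono) auto
    also have "\<dots> = inverse M" by (rule ennpowr_ennpowr_minus_one[OF p])
    finally have "average Q (weight_comp (mat 1) w) * ennpowr (average Q (\<lambda>x. ennpowr (w x) (- 1 / (p - 1)))) (p - 1)
        \<le> average Q w * inverse M"
      by (intro mult_mono) simp_all
    also have "\<dots> = ennreal K"
      using W K unfolding M_def
      by (cases "average Q w" rule: ennreal_cases)
        (auto simp: divide_ennreal inverse_ennreal ennreal_mult[symmetric])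
    finally show "average Q (weight_comp (mat 1) w) * ennpowr (average Q (\<lambda>x. ennpowr (w x) (- 1 / (p - 1)))) (p - 1)
        \<le> ennreal K" .
  qed
  then show ?thesis using wt by (auto simp: muckenhoupt_class_def intro: order.strict_trans1)
qed

section \<open>An A_1 weight singular on a hyperplane\<close>

text \<open>This is the power -1/2 of the distance to the hyperplane \<open>x $ i = c\<close>, with
  value infinity on it. The exponent is integrable across the singularity and has an elementary
  antiderivative.\<close>

definition coord_weight :: "'n \<Rightarrow> real \<Rightarrow> real^'n \<Rightarrow> ennreal" where
  "coord_weight i c x = inverse (ennreal (sqrt \<bar>x $ i - c\<bar>))"

text \<open>As \<^const>\<open>sqrt\<close> is extended to negative arguments as an odd function, \<open>2 * sqrt (t - c)\<close> is an
  antiderivative on both sides of the singularity.\<close>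

lemma nn_integral_inverse_sqrt_abs:
  fixes a b c :: real
  assumes "a \<le> b"
  shows "(\<integral>\<^sup>+t\<in>{a..b}. inverse (ennreal (sqrt \<bar>t - c\<bar>)) \<partial>lborel) = ennreal (2 * (sqrt (b - c) - sqrt (a - c)))"
proof -
  have "((\<lambda>t. inverse (sqrt \<bar>t - c\<bar>)) has_integral 2 * sqrt (b - c) - 2 * sqrt (a - c)) {a..b}"
  proof (rule fundamental_theorem_of_calculus_interior_strong[where S = "{c}"])
    fix t assume t: "t \<in> {a<..<b} - {c}"
    have "((\<lambda>t. 2 * sqrt (t - c)) has_real_derivative inverse (sqrt \<bar>t - c\<bar>)) (at t)"
    proof (cases "t < c")
      case True
      then have "((\<lambda>t. - 2 * sqrt (c - t)) has_real_derivative inverse (sqrt \<bar>t - c\<bar>)) (at t)"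
        by (auto intro!: derivative_eq_intros simp: field_simps)
      moreover have "- 2 * sqrt (c - t) = 2 * sqrt (t - c)" for t
        using real_sqrt_minus[of "t - c"] by simp
      ultimately show ?thesis by (simp only:)
    next
      case False
      then show ?thesis using t
        by (auto intro!: derivative_eq_intros simp: field_simps)
    qed
    then show "((\<lambda>t. 2 * sqrt (t - c)) has_vector_derivative inverse (sqrt \<bar>t - c\<bar>)) (at t)"
      by (simp add: has_real_derivative_iff_has_vector_derivative)
  qed (use assms in \<open>auto intro!: continuous_intros\<close>)
  then have "integral\<^sup>N lborel (\<lambda>t. ennreal (inverse (sqrt \<bar>t - c\<bar>)) * indicator {a..b} t)
      = ennreal (2 * sqrt (b - c) - 2 * sqrt (a - c))"
    by (intro nn_integral_has_integral_lebesgue') auto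
  \<comment> \<open>At \<open>t = c\<close> the real inverse is 0 while the extended one is
    infinity; a single point is null.\<close>
  moreover have "(\<integral>\<^sup>+t\<in>{a..b}. inverse (ennreal (sqrt \<bar>t - c\<bar>)) \<partial>lborel)
      = (\<integral>\<^sup>+t\<in>{a..b}. ennreal (inverse (sqrt \<bar>t - c\<bar>)) \<partial>lborel)"
    by (intro nn_integral_cong_AE eventually_mono[OF AE_lborel_singleton[of c]]) (auto simp: inverse_ennreal)
  ultimately show ?thesis by (simp add: algebra_simps)
qed

text \<open>This is the one-dimensional A_1 bound with denominators cleared. If \<open>a\<close> and
  \<open>b\<close> lie on the same side of 0, a difference of squares suffices; the factor 2 is
  spent when they lie on opposite sides.\<close>

lemma sqrt_diff_mult_sqrt_abs_le:
  assumes "a \<le> y" "y \<le> b"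
  shows "(sqrt b - sqrt a) * sqrt \<bar>y\<bar> \<le> 2 * (b - a)"
proof -
  define \<alpha> \<beta> where "\<alpha> = sqrt \<bar>a\<bar>" and "\<beta> = sqrt \<bar>b\<bar>"
  have pos: "\<alpha> \<ge> 0" "\<beta> \<ge> 0" and sq: "\<alpha>\<^sup>2 = \<bar>a\<bar>" "\<beta>\<^sup>2 = \<bar>b\<bar>" by (auto simp: \<alpha>_def \<beta>_def)
  have diff: "sqrt b - sqrt a \<ge> 0" using assms by simp
  consider "0 \<le> a" | "b \<le> 0" | "a < 0" "0 < b" by linarith
  then show ?thesis
  proof cases
    case 1
    have "(sqrt b - sqrt a) * sqrt \<bar>y\<bar> \<le> (\<beta> - \<alpha>) * (\<beta> + \<alpha>)"
    proof (rule mult_mono')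
      have "sqrt \<bar>y\<bar> \<le> \<beta>" using 1 assms by (simp add: \<beta>_def)
      then show "sqrt \<bar>y\<bar> \<le> \<beta> + \<alpha>" using pos by simp
    qed (use 1 assms in \<open>auto simp: \<alpha>_def \<beta>_def\<close>)
    also have "\<dots> = b - a" using sq 1 assms by (simp add: algebra_simps power2_eq_square)
    finally show ?thesis using assms by simp
  next
    case 2
    have s: "sqrt b = - \<beta>" "sqrt a = - \<alpha>"
      using 2 assms by (simp_all add: \<alpha>_def \<beta>_def real_sqrt_minus)
    have "(sqrt b - sqrt a) * sqrt \<bar>y\<bar> \<le> (\<alpha> - \<beta>) * (\<beta> + \<alpha>)"
    proof (rule mult_mono')
      have "sqrt \<bar>y\<bar> \<le> \<alpha>" using 2 assms by (simp add: \<alpha>_def)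
      then show "sqrt \<bar>y\<bar> \<le> \<beta> + \<alpha>" using pos by simp
    qed (use diff s in auto)
    also have "\<dots> = b - a" using sq 2 assms by (simp add: algebra_simps power2_eq_square)
    finally show ?thesis using assms by simp
  next
    case 3
    have "sqrt a = - \<alpha>" "sqrt b = \<beta>"
      using 3 by (simp_all add: \<alpha>_def \<beta>_def real_sqrt_minus)
    then have s: "sqrt b - sqrt a = \<beta> + \<alpha>" by simp
    have "\<bar>y\<bar> \<le> \<bar>a\<bar> \<or> \<bar>y\<bar> \<le> \<bar>b\<bar>" using assms by linarith
    then have "sqrt \<bar>y\<bar> \<le> \<alpha> \<or> sqrt \<bar>y\<bar> \<le> \<beta>" by (auto simp: \<alpha>_def \<beta>_def)
    then have "sqrt \<bar>y\<bar> \<le> \<beta> + \<alpha>" using pos by auto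
    then have "(sqrt b - sqrt a) * sqrt \<bar>y\<bar> \<le> (\<beta> + \<alpha>) * (\<beta> + \<alpha>)"
      unfolding s using pos by (intro mult_left_mono) auto
    also have "\<dots> \<le> 2 * (\<beta>\<^sup>2 + \<alpha>\<^sup>2)"
      using sum_squares_bound[of \<alpha> \<beta>] by (simp add: power2_eq_square algebra_simps)
    also have "\<dots> = 2 * (b - a)" using sq 3 by simp
    finally show ?thesis .
  qed
qed

lemma nn_integral_inverse_sqrt_abs_le:
  fixes a y l c :: real
  assumes "a \<le> y" "y \<le> a + l" "0 < l"
  shows "(\<integral>\<^sup>+t\<in>{a..a+l}. inverse (ennreal (sqrt \<bar>t - c\<bar>)) \<partial>lborel)
    \<le> ennreal (4 * l) * inverse (ennreal (sqrt \<bar>y - c\<bar>))"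
\<comment> \<open>At the singularity the right-hand side is infinite. Elsewhere the constant 4
  combines the 2 of the antiderivative with the 2 of the square root estimate.\<close>
proof (cases "y = c")
  case True
  then show ?thesis using assms by (simp add: ennreal_mult_top)
next
  case False
  have "(sqrt (a + l - c) - sqrt (a - c)) * sqrt \<bar>y - c\<bar> \<le> 2 * ((a + l - c) - (a - c))"
    using assms by (intro sqrt_diff_mult_sqrt_abs_le) auto
  then have "2 * (sqrt (a + l - c) - sqrt (a - c)) \<le> 4 * l * inverse (sqrt \<bar>y - c\<bar>)"
    using False by (simp add: field_simps)
  then have "ennreal (2 * (sqrt (a + l - c) - sqrt (a - c))) \<le> ennreal (4 * l) * ennreal (inverse (sqrt \<bar>y - c\<bar>))"
    using assms by (simp add: ennreal_mult[symmetric] ennreal_leI)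
  then show ?thesis
    using False assms by (simp add: nn_integral_inverse_sqrt_abs inverse_ennreal)
qed

text \<open>Tonelli: the integrand and the indicator of the cube both factor over the coordinates,
  and every direction other than \<open>i\<close> contributes a factor \<open>l\<close>.\<close>

lemma nn_integral_coord_weight_cube:
  fixes a :: "real^'n"
  assumes l: "0 < l"
  shows "(\<integral>\<^sup>+x\<in>cbox a (\<chi> i. a $ i + l). coord_weight i c x \<partial>lebesgue)
    = (\<integral>\<^sup>+t\<in>{a $ i..a $ i + l}. inverse (ennreal (sqrt \<bar>t - c\<bar>)) \<partial>lborel) * ennreal l ^ (CARD('n) - 1)"
proof -
  let ?e = "axis i 1 :: real^'n"
  have e: "?e \<in> Basis" by simp
  define h where "h b t = (if b = ?e then inverse (ennreal (sqrt \<bar>t - c\<bar>)) else 1)" for b t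
  define f where "f b t = h b t * indicator {a \<bullet> b..a \<bullet> b + l} t" for b t
  have h_prod: "(\<Prod>b\<in>Basis. h b (x \<bullet> b)) = coord_weight i c x" for x
    using e by (simp add: h_def coord_weight_def inner_axis cong: if_cong)
  have ind: "(\<Prod>b\<in>Basis. indicator {a \<bullet> b..a \<bullet> b + l} (x \<bullet> b)) = (indicator (cbox a (\<chi> i. a $ i + l)) x :: ennreal)" for x
  proof (cases "x \<in> cbox a (\<chi> i. a $ i + l)")
    case True
    then have "x \<bullet> b \<in> {a \<bullet> b..a \<bullet> b + l}" if "b \<in> Basis" for b
      using that unfolding cube_eq by (simp add: mem_box inner_add_left)
    with True show ?thesis by simp
  next
    case False
    then obtain b where "b \<in> Basis" "x \<bullet> b \<notin> {a \<bullet> b..a \<bullet> b + l}"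
      unfolding cube_eq by (auto simp: mem_box inner_add_left)
    then have "(\<Prod>b\<in>Basis. indicator {a \<bullet> b..a \<bullet> b + l} (x \<bullet> b)) = (0 :: ennreal)"
      by (intro prod_zero) (auto intro!: bexI[of _ b])
    with False show ?thesis by simp
  qed
  have "(\<integral>\<^sup>+x\<in>cbox a (\<chi> i. a $ i + l). coord_weight i c x \<partial>lebesgue) = (\<integral>\<^sup>+x. (\<Prod>b\<in>Basis. f b (x \<bullet> b)) \<partial>lborel)"
    unfolding nn_integral_completion f_def prod.distrib h_prod ind ..
  also have "\<dots> = (\<Prod>b\<in>Basis. (\<integral>\<^sup>+t. f b t \<partial>lborel))"
    by (intro nn_integral_lborel_prod) (auto simp: f_def h_def)
  also have "\<dots> = (\<integral>\<^sup>+t. f ?e t \<partial>lborel) * (\<Prod>b\<in>Basis - {?e}. (\<integral>\<^sup>+t. f b t \<partial>lborel))"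
    using e by (intro prod.remove) auto
  also have "(\<Prod>b\<in>Basis - {?e}. (\<integral>\<^sup>+t. f b t \<partial>lborel)) = (\<Prod>b\<in>Basis - {?e}. ennreal l)"
    using l by (intro prod.cong) (auto simp: f_def h_def)
  also have "\<dots> = ennreal l ^ (CARD('n) - 1)"
    using e by (simp add: card_Diff_singleton)
  also have "(\<integral>\<^sup>+t. f ?e t \<partial>lborel) = (\<integral>\<^sup>+t\<in>{a $ i..a $ i + l}. inverse (ennreal (sqrt \<bar>t - c\<bar>)) \<partial>lborel)"
    by (simp add: f_def h_def inner_axis)
  finally show ?thesis .
qed

text \<open>The side length in the one-dimensional bound and the \<open>l\<close> from each
  remaining direction combine to the volume of \<open>Q\<close>, so the constant 4 does not depend
  on the dimension.\<close>

lemma average_coord_weight_le: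
  fixes Q :: "(real^'n) set"
  assumes "Q \<in> cubes" "x \<in> Q"
  shows "average Q (coord_weight i c) \<le> ennreal 4 * coord_weight i c x"
proof -
  obtain a l where Q: "Q = cbox a (\<chi> i. a $ i + l)" and l: "l > 0"
    using assms(1) by (auto simp: cubes_def)
  have "a $ i \<le> x $ i" "x $ i \<le> a $ i + l" using assms(2) by (auto simp: Q mem_box_cart)
  from nn_integral_inverse_sqrt_abs_le[OF this l]
  have "(\<integral>\<^sup>+y\<in>Q. coord_weight i c y \<partial>lebesgue) \<le> ennreal (4 * l) * coord_weight i c x * ennreal l ^ (CARD('n) - 1)"
    unfolding Q nn_integral_coord_weight_cube[OF l] coord_weight_def[of i c x] by (rule mult_right_mono) simp
  also have "\<dots> = ennreal 4 * coord_weight i c x * ennreal (l ^ CARD('n))"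
  proof -
    have "ennreal l * ennreal l ^ (CARD('n) - 1) = ennreal (l ^ CARD('n))"
      using l by (simp add: ennreal_power ennreal_mult[symmetric] power_Suc[symmetric] del: power_Suc)
    moreover have "ennreal (4 * l) = ennreal 4 * ennreal l" using l by (simp add: ennreal_mult)
    ultimately show ?thesis by (metis mult.assoc mult.commute)
  qed
  finally have "average Q (coord_weight i c)
      \<le> ennreal 4 * coord_weight i c x * ennreal (l ^ CARD('n)) / ennreal (l ^ CARD('n))"
    unfolding average_def by (subst (2) Q, subst emeasure_cube[OF l]) (rule divide_right_mono_ennreal)
  also have "\<dots> = ennreal 4 * coord_weight i c x"
    using l by (subst ennreal_mult_divide_eq) auto
  finally show ?thesis .
qed

lemma weight_coord_weight: "weight (coord_weight i c :: real^'n \<Rightarrow> ennreal)"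
  unfolding weight_def
proof (intro conjI allI impI)
  have "(\<lambda>x::real^'n. x $ i) \<in> borel_measurable borel"
    by (intro borel_measurable_continuous_onI continuous_intros)
  then have "coord_weight i c \<in> borel_measurable (borel :: (real^'n) measure)"
    unfolding coord_weight_def by measurable
  then show "coord_weight i c \<in> borel_measurable (lebesgue :: (real^'n) measure)"
    by (simp add: measurable_completion)
next
  fix K :: "(real^'n) set" assume "compact K"
  then obtain Q where Q: "Q \<in> cubes" "K \<subseteq> Q"
    using bounded_subset_cube compact_imp_bounded by blast
  obtain a l where al: "Q = cbox a (\<chi> i. a $ i + l)" "l > 0"
    using Q(1) by (auto simp: cubes_def)
  have "(\<integral>\<^sup>+x\<in>K. coord_weight i c x \<partial>lebesgue) \<le> (\<integral>\<^sup>+x\<in>Q. coord_weight i c x \<partial>lebesgue)"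
    using Q(2) by (intro nn_integral_mono) (auto simp: indicator_def)
  also have "\<dots> < \<infinity>"
    unfolding al(1) nn_integral_coord_weight_cube[OF al(2)] using al(2)
    by (simp add: nn_integral_inverse_sqrt_abs ennreal_mult_less_top ennreal_power)
  finally show "(\<integral>\<^sup>+x\<in>K. coord_weight i c x \<partial>lebesgue) < \<infinity>" .
next
  have "negligible {x::real^'n. x \<bullet> axis i 1 = c}"
    by (rule negligible_standard_hyperplane) simp
  moreover have "{x. \<not> (0 < coord_weight i c x \<and> coord_weight i c x < \<infinity>)} \<subseteq> {x. x \<bullet> axis i 1 = c}"
    by (rule subsetI, rule ccontr) (simp add: coord_weight_def inverse_ennreal inner_axis)
  ultimately show "AE x in lebesgue. 0 < coord_weight i c x \<and> coord_weight i c (x::real^'n) < \<infinity>"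
    unfolding eventually_ae_filter_negligible by blast
qed

text \<open>The transformed weight blows up at \<open>x0\<close> while the original stays finite
  there, so any proposed bound fails on a whole neighbourhood, which is not null.\<close>

lemma not_ae_lesssim_coord_weight_comp:
  fixes A :: "real^'n^'n"
  assumes x0: "(A *v x0) $ i = c" "x0 $ i \<noteq> c"
  shows "\<not> ae_lesssim (weight_comp A (coord_weight i c)) (coord_weight i c)"
proof
  assume "ae_lesssim (weight_comp A (coord_weight i c)) (coord_weight i c)"
  then obtain C where C: "C > 0"
    and "AE x in lebesgue. coord_weight i c (A *v x) \<le> ennreal C * coord_weight i c x"
    unfolding ae_lesssim_def weight_comp_def by blast
  then obtain N where N: "negligible N" "{x. \<not> coord_weight i c (A *v x) \<le> ennreal C * coord_weight i c x} \<subseteq> N"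
    unfolding eventually_ae_filter_negligible by blast
  \<comment> \<open>Squaring and clearing denominators, this is the strict negation of the bound;
    continuity makes it open.\<close>
  define U where "U = {x. C\<^sup>2 * \<bar>(A *v x) $ i - c\<bar> < \<bar>x $ i - c\<bar>}"
  have "open U"
    unfolding U_def by (intro open_Collect_less continuous_intros)
  moreover have "x0 \<in> U" using x0 by (simp add: U_def)
  moreover have "U \<subseteq> N"
  proof -
    have "\<not> coord_weight i c (A *v x) \<le> ennreal C * coord_weight i c x" if x: "x \<in> U" for x
    proof
      assume le: "coord_weight i c (A *v x) \<le> ennreal C * coord_weight i c x"
      define u v where "u = \<bar>(A *v x) $ i - c\<bar>" and "v = \<bar>x $ i - c\<bar>"
      have uv: "C\<^sup>2 * u < v" "0 \<le> u" using x by (auto simp: U_def u_def v_def)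
      have "0 \<le> C\<^sup>2 * u" using uv by simp
      with uv have v: "0 < v" by linarith
      have le: "inverse (ennreal (sqrt u)) \<le> ennreal (C / sqrt v)"
        using le C v unfolding coord_weight_def u_def[symmetric] v_def[symmetric]
        by (simp add: inverse_ennreal ennreal_mult[symmetric] divide_inverse)
      then have "u \<noteq> 0" by (auto simp: top_unique)
      with uv le C v have "inverse (sqrt u) \<le> C / sqrt v"
        by (simp add: inverse_ennreal)
      then have "sqrt v \<le> C * sqrt u" using \<open>u \<noteq> 0\<close> uv v by (simp add: field_simps)
      then have "(sqrt v)\<^sup>2 \<le> (C * sqrt u)\<^sup>2" using v by (intro power_mono) auto
      then show False using uv v by (simp add: power_mult_distrib)
    qed
    with N(2) show ?thesis by blast
  qed
  ultimately show False
    using N(1) open_not_negligible negligible_subset by blast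
qed

theorem proposition1p8:
  fixes A :: "real ^ 'n ^ 'n" and k :: nat and p :: real
  assumes "invertible A" and "k \<ge> 1" and "mat_power A k = mat 1" and "1 < p"
  shows "muckenhoupt_class A p \<subseteq> classical_muckenhoupt_class p
    \<and> (A \<noteq> mat 1 \<longrightarrow> (\<exists>w. weight w \<and> w \<in> classical_muckenhoupt_class p - muckenhoupt_class A p))
    \<and> muckenhoupt_class A p
        = {w \<in> classical_muckenhoupt_class p. ae_lesssim (weight_comp A w) w}"
proof -
  note eq = muckenhoupt_class_eq[OF assms]
  \<comment> \<open>For \<open>A = mat 1\<close> the two classes coincide, so a separating weight
    requires that \<open>A\<close> move some point.\<close>
  have "\<exists>w. weight w \<and> w \<in> classical_muckenhoupt_class p - muckenhoupt_class A p" if "A \<noteq> mat 1"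
  proof -
    from that obtain x where "A *v x \<noteq> x"
      by (metis matrix_eq matrix_vector_mul_lid)
    then obtain i where i: "x $ i \<noteq> (A *v x) $ i" by (metis vec_eq_iff)
    \<comment> \<open>The singular hyperplane is placed through \<open>A *v x\<close> and misses
      \<open>x\<close>.\<close>
    let ?w = "coord_weight i ((A *v x) $ i)"
    have "?w \<in> classical_muckenhoupt_class p"
      using weight_coord_weight assms(4) average_coord_weight_le
      by (rule mem_classical_muckenhoupt_class_of_average_le)
    moreover have "?w \<notin> muckenhoupt_class A p"
      using not_ae_lesssim_coord_weight_comp[OF refl i] unfolding eq by blast
    ultimately show ?thesis using weight_coord_weight by blast
  qed
  with eq show ?thesis by blast
qed

end
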